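(* Let $A\in\mathbb{R}^{m\times n}$ have a nontrivial nullspace. Define $$\alpha_1(A)=\max_{x\neq 0,\;Ax=0}\frac{\|x\|_\infty}{\|x\|_1},\qquad S(A)=\max_{x\neq 0,\;Ax=0}\frac{\|x\|_2}{\|x\|_1},$$ $$SDP(A)=\max\left\{\operatorname{Tr}X:\ X\in\mathbf{S}_n,\ \operatorname{Tr}(A^TAX)=0,\ \|X\|_1\leq 1,\ X\succeq 0\right\}.$$ Then $$\alpha_1(A)\leq S(A)\leq\sqrt{SDP(A)}\leq\sqrt{\alpha_1(A)}.$$
   Context: $\mathbf{S}_n$ is the set of real symmetric $n\times n$ matrices, $X\succeq 0$ means that $X$ is positive semidefinite, and for a matrix $X$, $\|X\|_1=\sum_{i,j}|X_{ij}|$ is the entrywise $\ell_1$ norm. For vectors, $\|\cdot\|_1$, $\|\cdot\|_2$, $\|\cdot\|_\infty$ are the usual $\ell_1$, Euclidean and sup norms. *)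

theory Defs
  imports "HOL-Analysis.Analysis"
begin

definition l1_norm :: "real ^ 'n \<Rightarrow> real" where
  "l1_norm x = (\<Sum>i\<in>UNIV. \<bar>x $ i\<bar>)"

text \<open>Entrywise, not the operator norm induced by the vector norm above.\<close>

definition mat_l1_norm :: "real ^ 'n ^ 'n \<Rightarrow> real" where
  "mat_l1_norm X = (\<Sum>i\<in>UNIV. \<Sum>j\<in>UNIV. \<bar>X $ i $ j\<bar>)"

definition symmetric_matrices :: "(real ^ 'n ^ 'n) set" where
  "symmetric_matrices = {X. transpose X = X}"

text \<open>Symmetry is not part of this predicate; it is always required separately.\<close>

definition pos_semidef :: "real ^ 'n ^ 'n \<Rightarrow> bool" where
  "pos_semidef X \<longleftrightarrow> (\<forall>v. 0 \<le> v \<bullet> (X *v v))"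

definition is_maximum :: "real set \<Rightarrow> real \<Rightarrow> bool" where
  "is_maximum V M \<longleftrightarrow> M \<in> V \<and> (\<forall>v\<in>V. v \<le> M)"

definition alpha1_values :: "real ^ 'n ^ 'm \<Rightarrow> real set" where
  "alpha1_values A = {infnorm x / l1_norm x | x. x \<noteq> 0 \<and> A *v x = 0}"

definition S_values :: "real ^ 'n ^ 'm \<Rightarrow> real set" where
  "S_values A = {norm x / l1_norm x | x. x \<noteq> 0 \<and> A *v x = 0}"

definition SDP_values :: "real ^ 'n ^ 'm \<Rightarrow> real set" where
  "SDP_values A = {trace X | X. X \<in> symmetric_matrices \<and>
     trace (transpose A ** A ** X) = 0 \<and> mat_l1_norm X \<le> 1 \<and> pos_semidef X}"

text \<open>The constant \<^const>\<open>Greatest\<close> denotes the maximum, not merely the supremum,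
  and is unspecified when no maximum exists.\<close>

definition alpha1 :: "real ^ 'n ^ 'm \<Rightarrow> real" where
  "alpha1 A = (GREATEST r. r \<in> alpha1_values A)"

definition S_const :: "real ^ 'n ^ 'm \<Rightarrow> real" where
  "S_const A = (GREATEST r. r \<in> S_values A)"

definition SDP :: "real ^ 'n ^ 'm \<Rightarrow> real" where
  "SDP A = (GREATEST r. r \<in> SDP_values A)"

end

theory Submission
  imports Defs
begin

text \<open>The functions whose quotient defines \<open>\<alpha>\<^sub>1\<close> and \<open>S\<close> are homogeneous, so both maxima are
  taken over the compact \<open>\<ell>\<^sub>1\<close> unit sphere of the nullspace. The first inequality is
  \<open>\<parallel>x\<parallel>\<^sub>\<infinity> \<le> \<parallel>x\<parallel>\<^sub>2\<close>, and the second tests the semidefinite program on \<open>x x\<^sup>T / \<parallel>x\<parallel>\<^sub>1\<^sup>2\<close>.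
  For the third, \<open>Tr (A\<^sup>T A X)\<close> is the sum of the values of the form \<open>X\<close> at the rows of \<open>A\<close>, so for
  feasible \<open>X\<close> each of these values vanishes. Positive semidefiniteness then gives \<open>X A\<^sup>T = 0\<close>: the
  rows of \<open>X\<close> lie in the nullspace, and \<open>X\<^sub>i\<^sub>i\<close> is at most \<open>\<alpha>\<^sub>1\<close> times the \<open>\<ell>\<^sub>1\<close> norm of row \<open>i\<close>.\<close>

text \<open>\<open>GREATEST\<close> is unspecified where no maximum exists, so attainment has to
  come first. Compactness supplies it, and all three constants pass through this fact.\<close>

lemma is_maximum_Greatest:
  assumes "compact V" "V \<noteq> {}"
  shows "is_maximum V (GREATEST r. r \<in> V)"
proof -
  obtain M where M: "M \<in> V" "\<forall>v\<in>V. v \<le> M"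
    using compact_attains_sup[OF assms] by blast
  then have "(GREATEST r. r \<in> V) = M"
    by (intro Greatest_equality) auto
  with M show ?thesis
    by (simp add: is_maximum_def)
qed

section \<open>Entrywise norms of vectors and matrices\<close>

lemma l1_norm_nonneg: "0 \<le> l1_norm x"
  by (simp add: l1_norm_def sum_nonneg)

lemma norm_le_l1_norm: "norm x \<le> l1_norm x"
  unfolding l1_norm_def by (rule norm_le_l1_cart)

lemma l1_norm_pos: "x \<noteq> 0 \<Longrightarrow> 0 < l1_norm x"
  using norm_le_l1_norm[of x] by (meson less_le_trans zero_less_norm_iff)

lemma l1_norm_zero [simp]: "l1_norm 0 = 0"
  by (simp add: l1_norm_def)

lemma l1_norm_scaleR: "l1_norm (c *\<^sub>R x) = \<bar>c\<bar> * l1_norm x"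
  by (simp add: l1_norm_def abs_mult sum_distrib_left)

lemma continuous_on_l1_norm: "continuous_on S l1_norm"
  unfolding l1_norm_def by (intro continuous_intros)

lemma mat_l1_norm_eq_sum_rows: "mat_l1_norm X = (\<Sum>i\<in>UNIV. l1_norm (X $ i))"
  by (simp add: mat_l1_norm_def l1_norm_def)

lemma norm_le_mat_l1_norm: "norm X \<le> mat_l1_norm X"
proof -
  have "norm X \<le> (\<Sum>i\<in>UNIV. norm (X $ i))"
    unfolding norm_vec_def[of X] by (rule L2_set_le_sum) simp
  also have "\<dots> \<le> mat_l1_norm X"
    unfolding mat_l1_norm_eq_sum_rows by (intro sum_mono norm_le_l1_norm)
  finally show ?thesis .
qed

section \<open>Attainment of the two ratio maxima\<close>

lemma compact_l1_sphere_nullspace: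
  fixes A :: "real ^ 'n ^ 'm"
  shows "compact {x. l1_norm x = 1 \<and> A *v x = 0}"
proof -
  have "closed {x. l1_norm x = 1 \<and> A *v x = 0}"
    by (intro closed_Collect_conj closed_Collect_eq continuous_on_l1_norm
        linear_continuous_on matrix_vector_mul_bounded_linear continuous_intros)
  moreover have "bounded {x. l1_norm x = 1 \<and> A *v x = 0}"
    by (rule boundedI[of _ 1]) (metis (lifting) norm_le_l1_norm mem_Collect_eq)
  ultimately show ?thesis
    by (simp add: compact_eq_bounded_closed)
qed

lemma ratio_values_eq_image_sphere:
  fixes A :: "real ^ 'n ^ 'm"
  assumes hom: "\<And>c x. f (c *\<^sub>R x) = \<bar>c\<bar> * f x"
  shows "{f x / l1_norm x | x. x \<noteq> 0 \<and> A *v x = 0} = f ` {x. l1_norm x = 1 \<and> A *v x = 0}"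
    (is "?V = f ` ?K")
proof
  show "?V \<subseteq> f ` ?K"
  proof
    fix r assume "r \<in> ?V"
    then obtain x where x: "x \<noteq> 0" "A *v x = 0" "r = f x / l1_norm x"
      by blast
    let ?y = "inverse (l1_norm x) *\<^sub>R x"
    have "?y \<in> ?K"
      using x l1_norm_pos[of x] by (simp add: l1_norm_scaleR matrix_vector_mult_scaleR)
    moreover have "r = f ?y"
      using x l1_norm_pos[of x] by (simp add: hom divide_inverse)
    ultimately show "r \<in> f ` ?K"
      by blast
  qed
  show "f ` ?K \<subseteq> ?V"
  proof
    fix r assume "r \<in> f ` ?K"
    then obtain x where x: "l1_norm x = 1" "A *v x = 0" "r = f x"
      by blast
    then have "x \<noteq> 0"
      by auto
    with x show "r \<in> ?V"
      by (auto intro!: exI[of _ x])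
  qed
qed

text \<open>Keeping \<open>f\<close> abstract covers \<open>infnorm\<close> and \<open>norm\<close>
  at once. The set is a variable \<open>V\<close> with an equation so that
  \<open>alpha1_values_def\<close> and \<open>S_values_def\<close> can be plugged in
  directly.\<close>

lemma is_maximum_ratio:
  fixes A :: "real ^ 'n ^ 'm"
  assumes "\<And>c x. f (c *\<^sub>R x) = \<bar>c\<bar> * f x" "continuous_on UNIV f"
    and "\<exists>x. x \<noteq> 0 \<and> A *v x = 0"
    and "V = {f x / l1_norm x | x. x \<noteq> 0 \<and> A *v x = 0}"
  shows "is_maximum V (GREATEST r. r \<in> V)"
proof (rule is_maximum_Greatest)
  show "compact V"
    unfolding assms(4) ratio_values_eq_image_sphere[OF assms(1)]
    by (rule compact_continuous_image[OF continuous_on_subset[OF assms(2) subset_UNIV]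
          compact_l1_sphere_nullspace])
  show "V \<noteq> {}"
    using assms(3,4) by blast
qed

lemma is_maximum_alpha1:
  fixes A :: "real ^ 'n ^ 'm"
  assumes "\<exists>x. x \<noteq> 0 \<and> A *v x = 0"
  shows "is_maximum (alpha1_values A) (alpha1 A)"
  unfolding alpha1_def
  by (rule is_maximum_ratio[OF infnorm_mul continuous_on_infnorm[OF continuous_on_id]
        assms alpha1_values_def])

lemma is_maximum_S_const:
  fixes A :: "real ^ 'n ^ 'm"
  assumes "\<exists>x. x \<noteq> 0 \<and> A *v x = 0"
  shows "is_maximum (S_values A) (S_const A)"
  unfolding S_const_def
  by (rule is_maximum_ratio[OF norm_scaleR continuous_on_norm_id assms S_values_def])

section \<open>Attainment in the semidefinite program\<close>

lemma trace_transpose_mult_mult: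
  fixes A :: "real ^ 'n ^ 'm"
  shows "trace (transpose A ** A ** X) = (\<Sum>k\<in>UNIV. A $ k \<bullet> (X *v A $ k))"
proof -
  \<comment> \<open>By cyclicity of the trace, the values of the form at the rows of
    \<open>A\<close> become the diagonal entries of \<open>A ** (X ** transpose A)\<close>.\<close>
  have "trace (transpose A ** A ** X) = trace (A ** (X ** transpose A))"
    by (metis matrix_mul_assoc trace_mul_sym)
  then show ?thesis
    by (simp add: trace_def matrix_matrix_mult_def matrix_vector_mult_def transpose_def
        inner_vec_def)
qed

lemma compact_SDP_feasible:
  fixes A :: "real ^ 'n ^ 'm"
  shows "compact {X. X \<in> symmetric_matrices \<and>
     trace (transpose A ** A ** X) = 0 \<and> mat_l1_norm X \<le> 1 \<and> pos_semidef X}" (is "compact ?F")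
proof -
  \<comment> \<open>Every constraint is now an equation or a weak inequality between continuous
    functions of \<open>X\<close>, semidefiniteness being one inequality for each \<open>v\<close>;
    such sets are closed, and so are their intersections.\<close>
  have feasible_eq: "?F = {X. (\<forall>i j. X $ j $ i = X $ i $ j) \<and>
      (\<Sum>k\<in>UNIV. A $ k \<bullet> (X *v A $ k)) = 0 \<and> mat_l1_norm X \<le> 1 \<and> (\<forall>v. 0 \<le> v \<bullet> (X *v v))}"
    unfolding symmetric_matrices_def pos_semidef_def trace_transpose_mult_mult
    by (simp add: transpose_def vec_eq_iff)
  have form: "continuous_on UNIV (\<lambda>X :: real ^ 'n ^ 'n. v \<bullet> (X *v v))" for v
    unfolding matrix_vector_mult_def inner_vec_def by (simp, intro continuous_intros)
  have "continuous_on UNIV (mat_l1_norm :: real ^ 'n ^ 'n \<Rightarrow> real)"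
    unfolding mat_l1_norm_def by (intro continuous_intros)
  then have "closed ?F"
    unfolding feasible_eq
    by (intro closed_Collect_conj closed_Collect_all closed_Collect_eq closed_Collect_le
        form continuous_intros)
  moreover have "bounded ?F"
    by (rule boundedI[of _ 1]) (use norm_le_mat_l1_norm order_trans in blast)
  ultimately show ?thesis
    by (simp add: compact_eq_bounded_closed)
qed

lemma is_maximum_SDP:
  fixes A :: "real ^ 'n ^ 'm"
  shows "is_maximum (SDP_values A) (SDP A)"
  unfolding SDP_def
proof (rule is_maximum_Greatest)
  have eq: "SDP_values A = trace ` {X. X \<in> symmetric_matrices \<and>
     trace (transpose A ** A ** X) = 0 \<and> mat_l1_norm X \<le> 1 \<and> pos_semidef X}"
    unfolding SDP_values_def by blast
  have "continuous_on S trace" for S :: "(real ^ 'n ^ 'n) set"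
    unfolding trace_def by (intro continuous_intros)
  then show "compact (SDP_values A)"
    unfolding eq by (rule compact_continuous_image[OF _ compact_SDP_feasible])
  \<comment> \<open>The zero matrix is feasible for every \<open>A\<close>.\<close>
  have "(0 :: real ^ 'n ^ 'n) \<in> symmetric_matrices"
    by (simp add: symmetric_matrices_def transpose_def vec_eq_iff)
  moreover have "trace (transpose A ** A ** 0) = 0"
    by (simp only: trace_transpose_mult_mult) simp
  moreover have "mat_l1_norm (0 :: real ^ 'n ^ 'n) \<le> 1" "pos_semidef (0 :: real ^ 'n ^ 'n)"
    by (simp_all add: mat_l1_norm_def pos_semidef_def)
  ultimately show "SDP_values A \<noteq> {}"
    unfolding SDP_values_def by blast
qed

section \<open>Feasible matrices and the nullspace\<close>

lemma pos_semidef_null_vector: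
  assumes psd: "pos_semidef X" and sym: "transpose X = X" and null: "v \<bullet> (X *v v) = 0"
  shows "X *v v = 0"
proof (rule ccontr)
  assume "X *v v \<noteq> 0"
  \<comment> \<open>A nonnegative form that vanishes at \<open>v\<close> is minimal there, and
    \<open>w\<close> is half its gradient. If \<open>w\<close> were nonzero, a short step from
    \<open>v\<close> along \<open>-w\<close> would make the form negative.\<close>
  define w where "w = X *v v"
  define c where "c = w \<bullet> (X *v w)"
  have w: "0 < w \<bullet> w"
    using \<open>X *v v \<noteq> 0\<close> by (simp add: w_def)
  have c: "0 \<le> c"
    using psd by (simp add: c_def pos_semidef_def)
  have vw: "v \<bullet> (X *v w) = w \<bullet> w"
    by (metis dot_lmul_matrix sym transpose_matrix_vector w_def)
  have quad: "0 \<le> t * (t * c - 2 * (w \<bullet> w))" for t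
  proof -
    have "0 \<le> (v - t *\<^sub>R w) \<bullet> (X *v (v - t *\<^sub>R w))"
      using psd by (simp add: pos_semidef_def)
    also have "\<dots> = t * (t * c - 2 * (w \<bullet> w))"
      using null vw
      by (simp add: matrix_vector_mult_diff_distrib matrix_vector_mult_scaleR
          inner_diff_left inner_diff_right c_def w_def[symmetric] algebra_simps)
    finally show ?thesis .
  qed
  \<comment> \<open>This choice gives \<open>t * c \<le> w \<bullet> w\<close>, hence
    \<open>t * c < 2 * (w \<bullet> w)\<close>. Adding 1 to \<open>c\<close> avoids division by zero
    when \<open>c = 0\<close>.\<close>
  define t where "t = (w \<bullet> w) / (c + 1)"
  have t: "0 < t"
    using w c by (simp add: t_def)
  have "t * (c + 1) = w \<bullet> w"
    using c by (simp add: t_def)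
  then have "t * c - 2 * (w \<bullet> w) < 0"
    using t w unfolding distrib_left by linarith
  with quad[of t] t show False
    by (simp add: zero_le_mult_iff)
qed

lemma rows_of_feasible_in_nullspace:
  fixes A :: "real ^ 'n ^ 'm"
  assumes sym: "transpose X = X" and tr: "trace (transpose A ** A ** X) = 0"
    and psd: "pos_semidef X"
  shows "A *v (X $ i) = 0"
proof -
  have "(\<Sum>k\<in>UNIV. A $ k \<bullet> (X *v A $ k)) = 0"
    using tr by (simp only: trace_transpose_mult_mult)
  then have "A $ k \<bullet> (X *v A $ k) = 0" for k
    using psd by (subst (asm) sum_nonneg_eq_0_iff) (auto simp: pos_semidef_def)
  then have "X *v A $ k = 0" for k
    using pos_semidef_null_vector[OF psd sym] by blast
  \<comment> \<open>This inner product is component \<open>i\<close> of \<open>X *v A $ k\<close>;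
    with its factors exchanged it is component \<open>k\<close> of
    \<open>A *v (X $ i)\<close>.\<close>
  then have "X $ i \<bullet> A $ k = 0" for k
    by (metis matrix_vector_mul_component zero_index)
  then show ?thesis
    by (simp add: vec_eq_iff matrix_vector_mul_component inner_commute)
qed

text \<open>Clearing the denominator admits \<open>x = 0\<close>, which matters because rows of a
  feasible matrix may vanish.\<close>

lemma infnorm_le_alpha1_mult_l1_norm:
  fixes A :: "real ^ 'n ^ 'm"
  assumes "is_maximum (alpha1_values A) (alpha1 A)" "A *v x = 0"
  shows "infnorm x \<le> alpha1 A * l1_norm x"
proof (cases "x = 0")
  case False
  then have "infnorm x / l1_norm x \<le> alpha1 A"
    using assms unfolding is_maximum_def alpha1_values_def by blast
  then show ?thesis
    using l1_norm_pos[OF False] by (simp add: field_simps)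
qed (simp add: infnorm_0)

lemma alpha1_nonneg:
  assumes "is_maximum (alpha1_values A) (alpha1 A)"
  shows "0 \<le> alpha1 A"
  using assms by (auto simp: is_maximum_def alpha1_values_def infnorm_pos_le l1_norm_nonneg)

lemma SDP_value_le_alpha1:
  fixes A :: "real ^ 'n ^ 'm"
  assumes max: "is_maximum (alpha1_values A) (alpha1 A)" and r: "r \<in> SDP_values A"
  shows "r \<le> alpha1 A"
proof -
  obtain X where X: "transpose X = X" "trace (transpose A ** A ** X) = 0"
    "mat_l1_norm X \<le> 1" "pos_semidef X" and r: "r = trace X"
    using r by (auto simp: SDP_values_def symmetric_matrices_def)
  have "X $ i $ i \<le> alpha1 A * l1_norm (X $ i)" for i
    using component_le_infnorm_cart[of "X $ i" i]
      infnorm_le_alpha1_mult_l1_norm[OF max rows_of_feasible_in_nullspace[OF X(1,2,4), of i]]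
    by linarith
  then have "trace X \<le> (\<Sum>i\<in>UNIV. alpha1 A * l1_norm (X $ i))"
    unfolding trace_def by (rule sum_mono)
  also have "\<dots> = alpha1 A * mat_l1_norm X"
    by (simp add: mat_l1_norm_eq_sum_rows sum_distrib_left)
  \<comment> \<open>Replacing the factor \<open>mat_l1_norm X\<close> by its bound 1 relies on
    \<open>alpha1 A\<close> being nonnegative.\<close>
  also have "\<dots> \<le> alpha1 A"
    using X(3) alpha1_nonneg[OF max] by (simp add: mult_left_le)
  finally show ?thesis
    by (simp add: r)
qed

section \<open>Rank-one feasible matrices\<close>

lemma square_ratio_in_SDP_values:
  fixes A :: "real ^ 'n ^ 'm"
  assumes x: "x \<noteq> 0" "A *v x = 0"
  shows "(norm x / l1_norm x)\<^sup>2 \<in> SDP_values A"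
proof -
  define y where "y = inverse (l1_norm x) *\<^sub>R x"
  have y: "l1_norm y = 1" "A *v y = 0" "norm y = norm x / l1_norm x"
    using x l1_norm_pos[of x]
    by (simp_all add: y_def l1_norm_scaleR matrix_vector_mult_scaleR divide_inverse)
  define X where "X = (\<chi> i j. y $ i * y $ j)"
  \<comment> \<open>As \<open>X\<close> is the outer product of \<open>y\<close> with itself, its
    form at \<open>v\<close> is the square of \<open>y \<bullet> v\<close>. That is nonnegative, and
    it is zero at the rows of \<open>A\<close>, to which \<open>y\<close> is orthogonal.\<close>
  have Xv: "X *v v = (y \<bullet> v) *\<^sub>R y" for v
    by (simp add: X_def vec_eq_iff matrix_vector_mult_def inner_vec_def sum_distrib_left mult_ac)
  have "X \<in> symmetric_matrices"
    by (simp add: X_def symmetric_matrices_def transpose_def vec_eq_iff mult.commute)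
  moreover have "y \<bullet> A $ k = 0" for k
    by (metis y(2) inner_commute matrix_vector_mul_component zero_index)
  then have "trace (transpose A ** A ** X) = 0"
    by (simp only: trace_transpose_mult_mult Xv) simp
  moreover have "mat_l1_norm X = l1_norm y * l1_norm y"
    by (simp add: X_def mat_l1_norm_def l1_norm_def abs_mult sum_product)
  then have "mat_l1_norm X \<le> 1"
    by (simp add: y)
  moreover have "pos_semidef X"
    by (simp add: pos_semidef_def Xv inner_commute)
  moreover have "(norm x / l1_norm x)\<^sup>2 = trace X"
    unfolding y(3)[symmetric] by (simp add: X_def trace_def power2_norm_eq_inner inner_vec_def)
  ultimately show ?thesis
    unfolding SDP_values_def by blast
qed

theorem lemma4p2:
  fixes A :: "real ^ 'n ^ 'm"
  assumes "\<exists>x. x \<noteq> 0 \<and> A *v x = 0"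
  shows "is_maximum (alpha1_values A) (alpha1 A) \<and>
         is_maximum (S_values A) (S_const A) \<and>
         is_maximum (SDP_values A) (SDP A) \<and>
         alpha1 A \<le> S_const A \<and>
         S_const A \<le> sqrt (SDP A) \<and>
         sqrt (SDP A) \<le> sqrt (alpha1 A)"
proof (intro conjI)
  show alpha1: "is_maximum (alpha1_values A) (alpha1 A)"
    using assms by (rule is_maximum_alpha1)
  show S: "is_maximum (S_values A) (S_const A)"
    using assms by (rule is_maximum_S_const)
  show SDP: "is_maximum (SDP_values A) (SDP A)"
    by (rule is_maximum_SDP)
  show "alpha1 A \<le> S_const A"
  proof -
    \<comment> \<open>A maximiser for \<open>alpha1 A\<close> is an admissible competitor for
      \<open>S_const A\<close>.\<close>
    obtain x where x: "x \<noteq> 0" "A *v x = 0" "alpha1 A = infnorm x / l1_norm x"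
      using alpha1 by (auto simp: is_maximum_def alpha1_values_def)
    have "alpha1 A \<le> norm x / l1_norm x"
      unfolding x(3) by (intro divide_right_mono infnorm_le_norm l1_norm_nonneg)
    also have "\<dots> \<le> S_const A"
      using S x(1,2) unfolding is_maximum_def S_values_def by blast
    finally show ?thesis .
  qed
  show "S_const A \<le> sqrt (SDP A)"
  proof -
    obtain x where x: "x \<noteq> 0" "A *v x = 0" "S_const A = norm x / l1_norm x"
      using S by (auto simp: is_maximum_def S_values_def)
    then have "(S_const A)\<^sup>2 \<le> SDP A"
      using SDP square_ratio_in_SDP_values[OF x(1,2)] by (simp add: is_maximum_def)
    then show ?thesis
      by (rule real_le_rsqrt)
  qed
  show "sqrt (SDP A) \<le> sqrt (alpha1 A)"
    using SDP SDP_value_le_alpha1[OF alpha1] by (simp add: is_maximum_def)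
qed

end
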